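(* Let $G$ be a finite abelian group of odd order, and let $A\subseteq G$ be non-empty. Suppose that $r_A(d)\ge |A|/2$ for every $d\in A-A$. Then either $A-A$ is a subgroup of $G$, or $A$ is the union of two cosets of a subgroup $H\le G$, that is, there are $x,g\in G$ with $A=(x+H)\cup(x+g+H)$; in the latter case $$A-A=(-g+H)\cup H\cup(g+H),$$ and the image of $g$ in $G/H$ has odd order at least five.
   Context: For a finite non-empty subset $A$ of an abelian group $G$, $A-A=\{a-a':a,a'\in A\}$ and $r_A(d)=|\{(a,a')\in A^2: a-a'=d\}|$ for $d\in G$. The two alternatives are to be read as: either $A-A$ is a subgroup, or there exist $H,x,g$ having all the properties listed in the second alternative. *)

theory Defs
  imports "HOL-Algebra.Coset" "HOL-Algebra.Multiplicative_Group"
begin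

text \<open>
  Abelian groups are HOL-Algebra's \<open>comm_group\<close>, written multiplicatively:
  the difference \<open>a - a'\<close> is \<open>a \<otimes> inv a'\<close>, and the coset \<open>x + H\<close>
  is \<open>H #> x\<close>, which is also the library's form of the image of \<open>x\<close>
  in the quotient \<open>G Mod H\<close>.
\<close>

definition difference_set :: "('a, 'b) monoid_scheme \<Rightarrow> 'a set \<Rightarrow> 'a set" where
  "difference_set G A = {a \<otimes>\<^bsub>G\<^esub> inv\<^bsub>G\<^esub> a' | a a'. a \<in> A \<and> a' \<in> A}"

definition rep_count :: "('a, 'b) monoid_scheme \<Rightarrow> 'a set \<Rightarrow> 'a \<Rightarrow> nat" where
  "rep_count G A d = card {(a, a'). a \<in> A \<and> a' \<in> A \<and> a \<otimes>\<^bsub>G\<^esub> inv\<^bsub>G\<^esub> a' = d}"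

end

theory Submission
  imports Defs
begin

text \<open>
  Write \<open>D\<close> for the difference set, \<open>H\<close> for its stabiliser, and \<open>S d\<close> for the set of
  \<open>a \<in> A\<close> with \<open>a / d \<in> A\<close>. If \<open>d, e \<in> D\<close> but \<open>d / e \<notin> D\<close> (call such \<open>d\<close> and \<open>e\<close>
  partners), then \<open>S d\<close> and \<open>S e\<close> are disjoint, and since both contain at least half of \<open>A\<close>
  they are complementary halves. Every \<open>d \<in> D - H\<close> has a partner, and it follows that
  \<open>A\<close> is a union of cosets of \<open>H\<close> unless \<open>D = H\<close>. A second moment computation shows that the
  partner of \<open>d\<close> is unique modulo \<open>H\<close>. If \<open>D\<close> contained an element outside
  \<open>H\<close>, \<open>d H\<close> and \<open>e H\<close>, uniqueness would produce an element of order two modulo \<open>H\<close>,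
  which is impossible in odd order. Hence \<open>D\<close> consists of three cosets and, because
  \<open>card D + card H = 2 card A\<close>, \<open>A\<close> consists of two.
\<close>

section \<open>Quotients, squares and cosets in an abelian group\<close>

context comm_group
begin

abbreviation quotient_op (infixl "\<oslash>" 70)
  where "x \<oslash> y \<equiv> x \<otimes> inv y"

lemma quotient_op_cancel_left:
  assumes "x \<in> carrier G" "y \<in> carrier G"
  shows "x \<oslash> (x \<oslash> y) = y"
proof -
  have "x \<oslash> (x \<oslash> y) = x \<otimes> (y \<oslash> x)" using assms by (simp add: inv_mult_group)
  also have "\<dots> = y \<otimes> (x \<oslash> x)" using assms by (intro m_lcomm) auto
  finally show ?thesis using assms by simp
qed

lemma inv_quotient_op:
  assumes "x \<in> carrier G" "y \<in> carrier G"
  shows "inv (x \<oslash> y) = y \<oslash> x"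
  using assms by (simp add: inv_mult_group)

lemma quotient_op_commute:
  assumes "x \<in> carrier G" "y \<in> carrier G" "z \<in> carrier G"
  shows "x \<oslash> y \<oslash> z = x \<oslash> z \<oslash> y"
  using assms by (simp add: m_ac)

lemma quotient_op_swap:
  assumes "x \<in> carrier G" "y \<in> carrier G" "z \<in> carrier G"
  shows "x \<oslash> (y \<oslash> z) = z \<oslash> (y \<oslash> x)"
  using assms by (simp add: inv_mult_group m_ac)

lemma quotient_op_quotient_op_left:
  assumes "x \<in> carrier G" "y \<in> carrier G" "z \<in> carrier G"
  shows "(x \<oslash> y) \<oslash> (x \<oslash> z) = z \<oslash> y"
proof -
  have "(x \<oslash> y) \<oslash> (x \<oslash> z) = x \<oslash> (x \<oslash> z) \<oslash> y"
    using assms by (simp add: quotient_op_commute)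
  then show ?thesis using assms by (simp add: quotient_op_cancel_left)
qed

lemma quotient_op_cancel_right:
  assumes "x \<in> carrier G" "y \<in> carrier G"
  shows "x \<oslash> y \<otimes> y = x"
  using assms by (simp add: m_assoc)

lemma quotient_op_mult:
  assumes "x \<in> carrier G" "y \<in> carrier G" "z \<in> carrier G"
  shows "x \<otimes> y \<oslash> z = x \<oslash> z \<otimes> y"
  using assms by (simp add: m_ac)

text \<open>With \<open>order G = 2 * m + 1\<close>, \<open>x\<close> equals
  \<open>x [^] (2 * m + 2)\<close>, which is a power of \<open>x \<otimes> x\<close>.\<close>

lemma square_mem_subgroup:
  assumes "odd (order G)" "subgroup H G" "x \<in> carrier G" "x \<otimes> x \<in> H"
  shows "x \<in> H"
proof -
  interpret H: subgroup H G by fact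
  obtain m where m: "order G = 2 * m + 1" using assms(1) by (elim oddE)
  have pow: "y [^] n \<in> H" if "y \<in> H" for y and n :: nat
    using that by (induction n) auto
  have "x = x [^] (order G + 1)"
    using assms(3) by (simp add: pow_order_eq_1)
  also have "\<dots> = x [^] (2 * (m + 1))"
    using m by simp
  also have "\<dots> = (x \<otimes> x) [^] (m + 1)"
    using assms(3) by (simp only: nat_pow_pow[symmetric] numeral_2_eq_2) simp
  also have "\<dots> \<in> H" using assms(4) pow by blast
  finally show ?thesis .
qed

lemma rcosets_disjoint_iff:
  assumes "subgroup H G" "x \<in> carrier G" "y \<in> carrier G"
  shows "(H #> x) \<inter> (H #> y) = {} \<longleftrightarrow> x \<oslash> y \<notin> H"
proof -
  have "x \<oslash> y \<in> H \<longleftrightarrow> x \<in> H #> y"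
    using subgroup.rcos_module[OF assms(1) is_group assms(3,2)] by simp
  also have "\<dots> \<longleftrightarrow> (H #> x) \<inter> (H #> y) \<noteq> {}"
  proof
    assume "x \<in> H #> y"
    then show "(H #> x) \<inter> (H #> y) \<noteq> {}"
      using rcos_self[OF assms(2,1)] by blast
  next
    assume "(H #> x) \<inter> (H #> y) \<noteq> {}"
    then obtain z where "z \<in> H #> x" "z \<in> H #> y" by blast
    then have "H #> x = H #> y"
      using repr_independence assms by metis
    then show "x \<in> H #> y" using rcos_self[OF assms(2,1)] by simp
  qed
  finally show ?thesis by blast
qed

end

section \<open>Half-popular differences and partners\<close>

lemma (in comm_group) inv_mem_difference_set:
  assumes "A \<subseteq> carrier G" "d \<in> difference_set G A"
  shows "inv d \<in> difference_set G A"
proof -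
  obtain a b where ab: "a \<in> A" "b \<in> A" "d = a \<oslash> b"
    using assms(2) by (auto simp: difference_set_def)
  then have "inv d = b \<oslash> a" using assms(1) inv_quotient_op[of a b] by blast
  then show ?thesis using ab by (auto simp: difference_set_def)
qed

text \<open>This is the situation of the second alternative. The popularity bound is cleared of the
  fraction to stay in \<open>nat\<close>; odd order remains an explicit hypothesis of the lemmas
  that use it.\<close>

locale half_popular = comm_group G for G (structure) +
  fixes A :: "'a set"
  assumes A_carrier: "A \<subseteq> carrier G"
    and finite_A: "finite A"
    and A_nonempty: "A \<noteq> {}"
    and popular: "d \<in> difference_set G A \<Longrightarrow> card A \<le> 2 * rep_count G A d"
    and not_subgroup: "\<not> subgroup (difference_set G A) G"
begin

abbreviation D :: "'a set" where "D \<equiv> difference_set G A"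

definition S :: "'a \<Rightarrow> 'a set" where "S d = {a \<in> A. a \<oslash> d \<in> A}"

definition H :: "'a set" where "H = {h \<in> carrier G. \<forall>d\<in>D. h \<otimes> d \<in> D}"

lemma A_mem_carrier [simp]: "a \<in> A \<Longrightarrow> a \<in> carrier G"
  using A_carrier by blast

lemma D_I: "a \<in> A \<Longrightarrow> b \<in> A \<Longrightarrow> a \<oslash> b \<in> D"
  by (auto simp: difference_set_def)

lemma D_carrier [simp]: "d \<in> D \<Longrightarrow> d \<in> carrier G"
  by (auto simp: difference_set_def)

lemma D_inv: "d \<in> D \<Longrightarrow> inv d \<in> D"
  using inv_mem_difference_set A_carrier by blast

lemma D_commute: "x \<in> carrier G \<Longrightarrow> y \<in> carrier G \<Longrightarrow> x \<oslash> y \<in> D \<longleftrightarrow> y \<oslash> x \<in> D"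
  using D_inv inv_quotient_op by metis

lemma finite_D: "finite D"
proof -
  have "D = (\<lambda>(a, b). a \<oslash> b) ` (A \<times> A)" by (auto simp: difference_set_def)
  then show ?thesis using finite_A by simp
qed

lemma one_D: "\<one> \<in> D"
proof -
  obtain a where "a \<in> A" using A_nonempty by blast
  then show ?thesis using D_I[of a a] by simp
qed

lemma S_subset: "S d \<subseteq> A"
  by (auto simp: S_def)

lemma finite_S: "finite (S d)"
  using S_subset finite_A finite_subset by blast

lemma card_S: 
  assumes "d \<in> carrier G"
  shows "card (S d) = rep_count G A d"
proof -
  have "{(a, a'). a \<in> A \<and> a' \<in> A \<and> a \<oslash> a' = d} = (\<lambda>a. (a, a \<oslash> d)) ` S d" (is "?L = ?R")
  proof
    show "?L \<subseteq> ?R"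
    proof
      fix p assume "p \<in> ?L"
      then obtain a b where p: "p = (a, b)" "a \<in> A" "b \<in> A" "a \<oslash> b = d" by blast
      then have "a \<oslash> d = b" using quotient_op_cancel_left[of a b] by simp
      then show "p \<in> ?R" using p by (auto simp: S_def)
    qed
  next
    show "?R \<subseteq> ?L" using assms quotient_op_cancel_left by (auto simp: S_def)
  qed
  moreover have "inj_on (\<lambda>a. (a, a \<oslash> d)) (S d)"
    by (auto intro: inj_onI)
  ultimately show ?thesis
    by (simp add: rep_count_def card_image)
qed

lemma card_A_le: "d \<in> D \<Longrightarrow> card A \<le> 2 * card (S d)"
  using popular card_S by simp

lemma partner:
  assumes "d \<in> D" "e \<in> D" "d \<oslash> e \<notin> D"
  shows "S e = A - S d" "2 * card (S d) = card A"
proof -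
  have "a \<notin> S e" if "a \<in> S d" for a
  proof
    assume "a \<in> S e"
    \<comment> \<open>A common element \<open>a\<close> would exhibit \<open>d \<oslash> e\<close>
      as the quotient of \<open>a \<oslash> e\<close> by \<open>a \<oslash> d\<close>, both in
      \<open>A\<close>.\<close>
    then have "(a \<oslash> e) \<oslash> (a \<oslash> d) \<in> D"
      using that D_I by (auto simp: S_def)
    moreover have "a \<in> carrier G" using that by (simp add: S_def)
    ultimately show False
      using assms by (simp add: quotient_op_quotient_op_left)
  qed
  then have disj: "S d \<inter> S e = {}" by blast
  then have c: "card (S d \<union> S e) = card (S d) + card (S e)"
    by (simp add: card_Un_disjoint finite_S)
  have le: "card (S d \<union> S e) \<le> card A"
    using S_subset finite_A by (simp add: card_mono)
  show "2 * card (S d) = card A"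
    using c le card_A_le[OF assms(1)] card_A_le[OF assms(2)] by linarith
  have "S d \<union> S e = A"
    using c card_A_le[OF assms(1)] card_A_le[OF assms(2)] S_subset finite_A
    by (intro card_seteq) auto
  then show "S e = A - S d" using disj by blast
qed

section \<open>The stabiliser \<open>H\<close> of \<open>D\<close>, and \<open>A\<close> as a union
  of its cosets\<close>

lemma H_mult_D: "h \<in> H \<Longrightarrow> d \<in> D \<Longrightarrow> h \<otimes> d \<in> D"
  by (simp add: H_def)

lemma H_I: "h \<in> carrier G \<Longrightarrow> (\<And>d. d \<in> D \<Longrightarrow> h \<otimes> d \<in> D) \<Longrightarrow> h \<in> H"
  by (simp add: H_def)

lemma H_carrier [simp]: "h \<in> H \<Longrightarrow> h \<in> carrier G"
  by (simp add: H_def)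

lemma H_subset_D: "H \<subseteq> D"
proof
  fix h assume "h \<in> H"
  then show "h \<in> D" using H_mult_D[OF _ one_D] by fastforce
qed

lemma finite_H: "finite H"
  using H_subset_D finite_D finite_subset by blast

text \<open>\<open>H\<close> is defined by an inclusion only, so inverses need the symmetry of
  \<open>D\<close>: \<open>inv h \<otimes> d\<close> is the inverse of
  \<open>h \<otimes> inv d\<close>.\<close>

lemma subgroup_H: "subgroup H G"
proof (rule subgroupI)
  show "H \<subseteq> carrier G" by auto
  have "\<one> \<in> H" by (rule H_I) auto
  then show "H \<noteq> {}" by blast
next
  fix h assume h: "h \<in> H"
  have "inv h \<otimes> d \<in> D" if d: "d \<in> D" for d
  proof -
    have "inv (h \<otimes> inv d) \<in> D" by (intro D_inv H_mult_D h d)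
    then show ?thesis using h d by (simp add: inv_mult)
  qed
  then show "inv h \<in> H" using h by (intro H_I) auto
next
  fix h k assume "h \<in> H" "k \<in> H"
  then show "h \<otimes> k \<in> H" by (intro H_I) (simp_all add: m_assoc H_mult_D)
qed

sublocale H: subgroup H G
  by (rule subgroup_H)

lemma D_mult_H: "h \<in> H \<Longrightarrow> d \<in> D \<Longrightarrow> d \<otimes> h \<in> D"
  using H_mult_D m_comm D_carrier H_carrier by metis

lemma D_mult_H_iff: 
  assumes "h \<in> H" "d \<in> carrier G"
  shows "d \<otimes> h \<in> D \<longleftrightarrow> d \<in> D"
proof
  assume "d \<otimes> h \<in> D"
  then have "d \<otimes> h \<oslash> h \<in> D" using assms D_mult_H by simp
  then show "d \<in> D" using assms by (simp add: m_assoc)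
qed (use assms D_mult_H in blast)

lemma rcos_subset_D: "d \<in> D \<Longrightarrow> H #> d \<subseteq> D"
  by (auto simp: r_coset_def H_mult_D)

text \<open>Some \<open>c \<in> D\<close> witnesses that \<open>d\<close> does not stabilise
  \<open>D\<close>; by symmetry of \<open>D\<close>, \<open>inv c\<close> is a partner.\<close>

lemma partner_exists:
  assumes "d \<in> D" "d \<notin> H"
  obtains e where "e \<in> D" "d \<oslash> e \<notin> D"
proof -
  obtain c where "c \<in> D" "d \<otimes> c \<notin> D" using assms H_I[of d] by auto
  then show thesis using D_inv that[of "inv c"] by simp
qed

text \<open>A partner \<open>e\<close> of \<open>d\<close> is also a partner of
  \<open>d \<otimes> h\<close>, and \<open>S e\<close> determines both sets as its complement in
  \<open>A\<close>.\<close>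

lemma S_mult_H:
  assumes "d \<in> D" "d \<notin> H" "h \<in> H"
  shows "S (d \<otimes> h) = S d"
proof -
  obtain e where e: "e \<in> D" "d \<oslash> e \<notin> D" using partner_exists assms by blast
  have "d \<otimes> h \<oslash> e \<notin> D"
    using e assms by (simp add: quotient_op_mult D_mult_H_iff)
  moreover have "d \<otimes> h \<in> D" using assms D_mult_H by blast
  ultimately have "S e = A - S (d \<otimes> h)" "S e = A - S d"
    using e assms partner by blast+
  then show ?thesis using S_subset by blast
qed

lemma D_not_subset_H: "\<not> D \<subseteq> H"
  using H_subset_D subgroup_H not_subgroup by (metis subset_antisym)

text \<open>If \<open>A\<close> lay in a single coset of \<open>H\<close>, then \<open>D\<close>
  would equal \<open>H\<close> and be a subgroup.\<close>

lemma A_other_coset: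
  assumes "a \<in> A"
  obtains b where "b \<in> A" "b \<oslash> a \<notin> H"
proof -
  have "\<exists>b\<in>A. b \<oslash> a \<notin> H"
  proof (rule ccontr)
    assume "\<not> ?thesis"
    then have in_H: "b \<oslash> a \<in> H" if "b \<in> A" for b using that by blast
    have "D \<subseteq> H"
    proof
      fix d assume "d \<in> D"
      then obtain b c where bc: "b \<in> A" "c \<in> A" "d = b \<oslash> c" by (auto simp: difference_set_def)
      have "(b \<oslash> a) \<oslash> (c \<oslash> a) \<in> H" using in_H bc by simp
      moreover have "(b \<oslash> a) \<oslash> (c \<oslash> a) = b \<oslash> c"
        using bc assms by (simp add: inv_quotient_op m_assoc[symmetric] quotient_op_cancel_right)
      ultimately show "d \<in> H" using bc by simp
    qed
    then show False using D_not_subset_H by blast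
  qed
  then show thesis using that by blast
qed

text \<open>For \<open>d\<close> outside \<open>H\<close>, \<open>S d\<close> depends only on the coset of \<open>d\<close>,
  so \<open>b \<oslash> a\<close> and \<open>b \<oslash> (a \<otimes> h)\<close> are differences realised at the same \<open>b\<close>.\<close>

lemma A_mult_H:
  assumes a: "a \<in> A" and h: "h \<in> H"
  shows "a \<otimes> h \<in> A"
proof -
  obtain b where b: "b \<in> A" "b \<oslash> a \<notin> H" using A_other_coset a by blast
  have "b \<in> S (b \<oslash> a)" using a b by (simp add: S_def quotient_op_cancel_left)
  also have "S (b \<oslash> a) = S (b \<oslash> a \<otimes> inv h)"
    using a b h by (simp add: S_mult_H D_I)
  finally have "b \<oslash> (b \<oslash> a \<otimes> inv h) \<in> A" by (simp add: S_def)
  moreover have "b \<oslash> a \<otimes> inv h = b \<oslash> (a \<otimes> h)" using a b h by (simp add: inv_mult m_assoc)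
  ultimately show ?thesis using a b h by (simp add: quotient_op_cancel_left)
qed

lemma S_H: "h \<in> H \<Longrightarrow> S h = A"
  using A_mult_H by (auto simp: S_def)

text \<open>Existence of partners sharpens the popularity bound to exact values, half of
  \<open>A\<close> outside \<open>H\<close> and all of \<open>A\<close> on \<open>H\<close>; this
  makes the moments below computable.\<close>

lemma card_S_eq: 
  assumes "d \<in> D"
  shows "2 * card (S d) = card A * (1 + of_bool (d \<in> H))"
proof (cases "d \<in> H")
  case False
  then obtain e where "e \<in> D" "d \<oslash> e \<notin> D" using assms partner_exists by blast
  then show ?thesis using False assms partner(2) by simp
qed (simp add: S_H)

section \<open>First and second moments of \<open>card (S f \<inter> X)\<close>\<close>

lemma card_quotients_mem_A:
  assumes "x \<in> A"
  shows "card {f \<in> D. x \<oslash> f \<in> A} = card A"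
proof -
  have "{f \<in> D. x \<oslash> f \<in> A} = (\<lambda>b. x \<oslash> b) ` A" (is "?L = ?R")
  proof
    show "?L \<subseteq> ?R"
    proof
      fix f assume "f \<in> ?L"
      then show "f \<in> ?R" using assms by (intro image_eqI[of _ _ "x \<oslash> f"]) (auto simp: quotient_op_cancel_left)
    qed
  qed (use assms in \<open>auto simp: quotient_op_cancel_left D_I\<close>)
  moreover have "inj_on (\<lambda>b. x \<oslash> b) A"
    using assms by (intro inj_on_inverseI[of _ "\<lambda>c. x \<oslash> c"]) (simp add: quotient_op_cancel_left)
  ultimately show ?thesis by (simp add: card_image)
qed

text \<open>Substitute \<open>b = x \<oslash> f\<close>: then
  \<open>y \<oslash> f = b \<oslash> (x \<oslash> y)\<close>, so the two conditions say
  \<open>b \<in> S (x \<oslash> y)\<close>, and \<open>f \<in> D\<close> is automatic.\<close>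

lemma card_common_quotients_mem_A:
  assumes "x \<in> A" "y \<in> A"
  shows "card {f \<in> D. x \<oslash> f \<in> A \<and> y \<oslash> f \<in> A} = card (S (x \<oslash> y))"
proof -
  have "{f \<in> D. x \<oslash> f \<in> A \<and> y \<oslash> f \<in> A} = (\<lambda>b. x \<oslash> b) ` S (x \<oslash> y)" (is "?L = ?R")
  proof
    show "?L \<subseteq> ?R"
    proof
      fix f assume f: "f \<in> ?L"
      have "x \<oslash> f \<oslash> (x \<oslash> y) = y \<oslash> f"
        using assms f by (simp add: quotient_op_quotient_op_left)
      then have "x \<oslash> f \<in> S (x \<oslash> y)" using f by (simp add: S_def)
      then show "f \<in> ?R"
        using assms f by (intro image_eqI[of _ _ "x \<oslash> f"]) (auto simp: quotient_op_cancel_left)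
    qed
  next
    show "?R \<subseteq> ?L"
    proof
      fix f assume "f \<in> ?R"
      then obtain b where b: "b \<in> A" "b \<oslash> (x \<oslash> y) \<in> A" "f = x \<oslash> b" by (auto simp: S_def)
      moreover have "y \<oslash> f = b \<oslash> (x \<oslash> y)" using b assms quotient_op_swap by simp
      ultimately show "f \<in> ?L" using assms by (simp add: quotient_op_cancel_left D_I)
    qed
  qed
  moreover have "inj_on (\<lambda>b. x \<oslash> b) (S (x \<oslash> y))"
    using assms by (intro inj_on_inverseI[of _ "\<lambda>c. x \<oslash> c"]) (simp add: S_def quotient_op_cancel_left)
  ultimately show ?thesis by (simp add: card_image)
qed

lemma card_Int_S:
  assumes "X \<subseteq> A"
  shows "card (S f \<inter> X) = (\<Sum>x\<in>X. of_bool (x \<oslash> f \<in> A))"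
proof -
  have "S f \<inter> X = {x \<in> X. x \<oslash> f \<in> A}" using assms by (auto simp: S_def)
  moreover have "finite X" using assms finite_A finite_subset by blast
  ultimately show ?thesis by (simp add: sum_of_bool_eq Int_def)
qed

lemma sum_card_Int_S:
  assumes "X \<subseteq> A"
  shows "(\<Sum>f\<in>D. card (S f \<inter> X)) = card X * card A"
proof -
  have "(\<Sum>f\<in>D. card (S f \<inter> X)) = (\<Sum>x\<in>X. \<Sum>f\<in>D. of_bool (x \<oslash> f \<in> A))"
    using assms by (simp only: card_Int_S) (rule sum.swap)
  also have "\<dots> = (\<Sum>x\<in>X. card {f \<in> D. x \<oslash> f \<in> A})"
    using finite_D by (simp add: sum_of_bool_eq Int_def)
  also have "\<dots> = (\<Sum>x\<in>X. card A)"
    using assms by (intro sum.cong) (auto simp: card_quotients_mem_A)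
  finally show ?thesis by simp
qed

text \<open>The square counts pairs \<open>(x, y)\<close> with both \<open>x \<oslash> f\<close> and
  \<open>y \<oslash> f\<close> in \<open>A\<close>; exchanging the sums leaves the previous count
  for each pair.\<close>

lemma sum_card_Int_S_square:
  assumes "X \<subseteq> A"
  shows "(\<Sum>f\<in>D. (card (S f \<inter> X))\<^sup>2) = (\<Sum>x\<in>X. \<Sum>y\<in>X. card (S (x \<oslash> y)))"
proof -
  have "(\<Sum>f\<in>D. (card (S f \<inter> X))\<^sup>2) =
      (\<Sum>f\<in>D. \<Sum>x\<in>X. \<Sum>y\<in>X. of_bool (x \<oslash> f \<in> A \<and> y \<oslash> f \<in> A))"
    using assms by (simp add: card_Int_S power2_eq_square sum_product of_bool_conj)
  also have "\<dots> = (\<Sum>x\<in>X. \<Sum>f\<in>D. \<Sum>y\<in>X. of_bool (x \<oslash> f \<in> A \<and> y \<oslash> f \<in> A))"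
    by (rule sum.swap)
  also have "\<dots> = (\<Sum>x\<in>X. \<Sum>y\<in>X. \<Sum>f\<in>D. of_bool (x \<oslash> f \<in> A \<and> y \<oslash> f \<in> A))"
    by (intro sum.cong refl sum.swap)
  also have "\<dots> = (\<Sum>x\<in>X. \<Sum>y\<in>X. card {f \<in> D. x \<oslash> f \<in> A \<and> y \<oslash> f \<in> A})"
    using finite_D by (simp add: sum_of_bool_eq Int_def)
  also have "\<dots> = (\<Sum>x\<in>X. \<Sum>y\<in>X. card (S (x \<oslash> y)))"
    using assms by (intro sum.cong refl card_common_quotients_mem_A) auto
  finally show ?thesis .
qed

text \<open>Evaluate the first moment with \<open>X = A\<close> in two ways, by double counting and
  by the exact values of \<open>card (S f)\<close>, then cancel \<open>card A\<close>.\<close>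

lemma card_D: "card D + card H = 2 * card A"
proof -
  have "2 * (\<Sum>f\<in>D. card (S f \<inter> A)) = (\<Sum>f\<in>D. card A * (1 + of_bool (f \<in> H)))"
    using S_subset by (simp add: sum_distrib_left card_S_eq Int_absorb2)
  also have "\<dots> = card A * (card D + card (D \<inter> H))"
    using finite_D by (simp only: sum_distrib_left[symmetric] sum.distrib) simp
  also have "D \<inter> H = H" using H_subset_D by blast
  finally have "card A * (2 * card A) = card A * (card D + card H)"
    using sum_card_Int_S[of A] by (simp only: subset_refl mult.left_commute[of 2])
  then show ?thesis using A_nonempty finite_A by (metis card_0_eq mult_cancel1)
qed

section \<open>Uniqueness of partners and the three cosets of \<open>D\<close>\<close>

lemma card_rcos: "x \<in> carrier G \<Longrightarrow> card (H #> x) = card H"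
  using card_rcosets_equal[of "H #> x" H] rcosetsI[of H x] H.subset by simp

lemma finite_rcos: "x \<in> carrier G \<Longrightarrow> finite (H #> x)"
  using rcosets_finite[of "H #> x" H] rcosetsI[of H x] H.subset finite_H by simp

text \<open>Variance argument: with \<open>X = S d\<close> and \<open>k = card X\<close>, the squared deviations of
  \<open>card (S f \<inter> X)\<close> from \<open>k / 2\<close> are maximal on the cosets of \<open>\<one>\<close>, \<open>d\<close>,
  \<open>y\<close> and \<open>y'\<close>, and the second moment leaves room for only three such cosets.\<close>

lemma partner_unique:
  assumes d: "d \<in> D" and y: "y \<in> D" "d \<oslash> y \<notin> D" and y': "y' \<in> D" "d \<oslash> y' \<notin> D"
  shows "y \<oslash> y' \<in> H"
proof (rule ccontr)
  assume neq: "y \<oslash> y' \<notin> H"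
  define X k n h where "X = S d" and "k = int (card X)" and "n = int (card A)" and "h = int (card H)"
  have X: "X \<subseteq> A" using S_subset X_def by simp
  have finite_X: "finite X" using X finite_A finite_subset by blast
  have nk: "n = 2 * k" using partner[OF d y] by (simp add: n_def k_def X_def)
  have "n > 0" using A_nonempty finite_A by (simp add: n_def card_gt_0_iff)
  then have "k > 0" using nk by simp
  have "H \<noteq> {}" using H.one_closed by blast
  then have "h > 0" using finite_H by (simp add: h_def card_gt_0_iff)
  define u where "u f = int (card (S f \<inter> X))" for f
  \<comment> \<open>\<open>X\<close> is stable under \<open>H\<close> because \<open>A\<close> is,
    so it contains the whole coset of each of its points.\<close>
  have coset_X: "card {y \<in> X. x \<oslash> y \<in> H} = card H" if x: "x \<in> X" for x
  proof -
    have xG: "x \<in> carrier G" using x X by auto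
    have "{y \<in> X. x \<oslash> y \<in> H} = (\<lambda>h. x \<oslash> h) ` H" (is "?L = ?R")
    proof
      show "?L \<subseteq> ?R"
      proof
        fix y assume y: "y \<in> ?L"
        then have "y \<in> carrier G" using X by auto
        then show "y \<in> ?R"
          using y xG by (intro image_eqI[of _ _ "x \<oslash> y"]) (auto simp: quotient_op_cancel_left)
      qed
    next
      show "?R \<subseteq> ?L"
      proof
        fix y assume "y \<in> ?R"
        then obtain h where h: "h \<in> H" "y = x \<oslash> h" by blast
        have "x \<in> A" "x \<oslash> d \<in> A" using x by (auto simp: X_def S_def)
        then have "x \<oslash> h \<in> A" "x \<oslash> d \<oslash> h \<in> A" using h A_mult_H by auto
        then have "y \<in> X" using d h xG by (simp add: X_def S_def quotient_op_commute)
        then show "y \<in> ?L" using h xG by (simp add: quotient_op_cancel_left)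
      qed
    qed
    moreover have "inj_on (\<lambda>h. x \<oslash> h) H"
      using xG by (intro inj_on_inverseI[of _ "\<lambda>c. x \<oslash> c"]) (simp add: quotient_op_cancel_left)
    ultimately show ?thesis by (simp add: card_image)
  qed
  have card_S_X: "int (card (S (x \<oslash> y))) = k + k * of_bool (x \<oslash> y \<in> H)"
    if "x \<in> X" "y \<in> X" for x y
  proof -
    have "x \<oslash> y \<in> D" using that X D_I by blast
    then have "2 * card (S (x \<oslash> y)) = card A * (1 + of_bool (x \<oslash> y \<in> H))" by (rule card_S_eq)
    then show ?thesis using nk unfolding n_def by (cases "x \<oslash> y \<in> H") auto
  qed
  have sum_u: "(\<Sum>f\<in>D. u f) = 2 * k\<^sup>2"
    using sum_card_Int_S[OF X, THEN arg_cong, of int] nk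
    by (simp add: u_def k_def n_def power2_eq_square)
  have "(\<Sum>f\<in>D. (u f)\<^sup>2) = (\<Sum>x\<in>X. \<Sum>y\<in>X. int (card (S (x \<oslash> y))))"
    using sum_card_Int_S_square[OF X, THEN arg_cong, of int] by (simp add: u_def)
  also have "\<dots> = (\<Sum>x\<in>X. \<Sum>y\<in>X. k + k * of_bool (x \<oslash> y \<in> H))"
    by (intro sum.cong refl card_S_X)
  also have "\<dots> = (\<Sum>x\<in>X. k * k + k * int (card {y \<in> X. x \<oslash> y \<in> H}))"
    using finite_X by (simp add: sum.distrib sum_of_bool_eq Int_def k_def flip: sum_distrib_left)
  also have "\<dots> = (\<Sum>x\<in>X. k * k + k * h)"
    using coset_X by (intro sum.cong) (auto simp: h_def)
  also have "\<dots> = k * (k * k + k * h)" by (simp add: k_def)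
  finally have sum_u2: "(\<Sum>f\<in>D. (u f)\<^sup>2) = k * (k * k + k * h)" .
  have D_eq: "int (card D) = 4 * k - h"
    using card_D nk by (simp add: n_def h_def)
  \<comment> \<open>Doubling the deviation avoids fractions. The moments give \<open>4 * k * (k * k
    + k * h) - 8 * k * k * k + (4 * k - h) * k * k\<close>, where the cubes cancel.\<close>
  have "(\<Sum>f\<in>D. (2 * u f - k)\<^sup>2) = (\<Sum>f\<in>D. 4 * (u f)\<^sup>2 - 4 * k * u f + k\<^sup>2)"
    by (intro sum.cong) (auto simp: power2_eq_square algebra_simps)
  also have "\<dots> = 4 * (\<Sum>f\<in>D. (u f)\<^sup>2) - 4 * k * (\<Sum>f\<in>D. u f) + int (card D) * k\<^sup>2"
    by (simp add: sum.distrib sum_subtractf sum_distrib_left)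
  also have "\<dots> = 3 * h * k\<^sup>2"
    unfolding sum_u sum_u2 D_eq by (simp add: power2_eq_square algebra_simps)
  finally have total: "(\<Sum>f\<in>D. (2 * u f - k)\<^sup>2) = 3 * h * k\<^sup>2" .

  have notin_H: "z \<notin> H" "d \<notin> H" "d \<oslash> z \<notin> H" if "z \<in> D" "d \<oslash> z \<notin> D" for z
  proof -
    show "z \<notin> H"
    proof
      assume "z \<in> H" then show False using that d D_mult_H[of "inv z" d] by simp
    qed
    show "d \<notin> H"
    proof
      assume "d \<in> H" then show False using that D_inv H_mult_D by blast
    qed
    show "d \<oslash> z \<notin> H" using that H_subset_D by blast
  qed
  \<comment> \<open>\<open>u f\<close> is \<open>k\<close> on \<open>H\<close> and on the coset of
    \<open>d\<close>, where \<open>S f\<close> is \<open>A\<close> and \<open>X\<close>, and it is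
    \<open>0\<close> on cosets of partners, where \<open>S f = A - X\<close>. In each case
    \<open>2 * u f - k\<close> is \<open>k\<close> or \<open>- k\<close>.\<close>
  have deviation_1: "(2 * u f - k)\<^sup>2 = k\<^sup>2" if "f \<in> H #> \<one>" for f
    using that X H.subset S_H by (simp add: u_def k_def Int_absorb1)
  have S_coset: "S f = S z" if z: "z \<in> D" "z \<notin> H" and f: "f \<in> H #> z" for f z
  proof -
    obtain c where c: "c \<in> H" "f = c \<otimes> z" using f by (auto simp: r_coset_def)
    have "f = z \<otimes> c" unfolding c(2) by (intro m_comm H_carrier D_carrier c(1) z(1))
    then show ?thesis using S_mult_H[OF z c(1)] by (simp only:)
  qed
  have deviation_d: "(2 * u f - k)\<^sup>2 = k\<^sup>2" if "f \<in> H #> d" for f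
    using S_coset[OF d notin_H(2)[OF y] that] by (simp add: u_def k_def X_def)
  have deviation_partner: "(2 * u f - k)\<^sup>2 = k\<^sup>2" if "z \<in> D" "d \<oslash> z \<notin> D" "f \<in> H #> z" for f z
  proof -
    have "S f = A - X"
      unfolding X_def partner(1)[OF d that(1,2), symmetric]
      by (intro S_coset that notin_H(1))
    then have "S f \<inter> X = {}" by blast
    then show ?thesis by (simp add: u_def)
  qed
  define U where "U = (H #> \<one>) \<union> (H #> d) \<union> (H #> y) \<union> (H #> y')"
  have "U \<subseteq> D"
    unfolding U_def by (intro Un_least rcos_subset_D one_D d y(1) y'(1))
  have inv_notin: "\<one> \<oslash> z \<notin> H" if "z \<notin> H" "z \<in> D" for z
    using that H.m_inv_closed[of "inv z"] inv_inv[of z] by (metis D_carrier inv_closed l_one)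
  have disj: "(H #> \<one>) \<inter> (H #> d) = {}" "(H #> \<one>) \<inter> (H #> y) = {}" "(H #> \<one>) \<inter> (H #> y') = {}"
    "(H #> d) \<inter> (H #> y) = {}" "(H #> d) \<inter> (H #> y') = {}" "(H #> y) \<inter> (H #> y') = {}"
    using rcosets_disjoint_iff[OF subgroup_H] notin_H[OF y] notin_H[OF y'] neq d y(1) y'(1)
      inv_notin D_carrier one_closed by metis+
  have "card U = 4 * card H"
  proof -
    have fin: "finite (H #> \<one>)" "finite (H #> d)" "finite (H #> y)" "finite (H #> y')"
      by (intro finite_rcos D_carrier one_D d y(1) y'(1))+
    have "card U = card (H #> \<one>) + card (H #> d) + card (H #> y) + card (H #> y')"
      unfolding U_def using fin disj
      by (simp add: card_Un_disjoint Int_Un_distrib2 del: coset_mult_one)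
    then show ?thesis using d y y' card_rcos by (simp del: coset_mult_one)
  qed
  \<comment> \<open>Four disjoint cosets contribute \<open>4 * h * k * k\<close>, more than the
    total \<open>3 * h * k * k\<close> over \<open>D\<close>.\<close>
  then have "4 * h * k\<^sup>2 = (\<Sum>f\<in>U. k\<^sup>2)" by (simp add: h_def)
  also have "\<dots> = (\<Sum>f\<in>U. (2 * u f - k)\<^sup>2)"
    using deviation_1 deviation_d deviation_partner y y'
    by (intro sum.cong) (auto simp: U_def)
  also have "\<dots> \<le> (\<Sum>f\<in>D. (2 * u f - k)\<^sup>2)"
    using \<open>U \<subseteq> D\<close> finite_D by (intro sum_mono2) auto
  finally have "h * k\<^sup>2 \<le> 0" using total by (simp add: algebra_simps)
  then show False using \<open>h > 0\<close> \<open>k > 0\<close> by (simp add: mult_le_0_iff)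
qed

text \<open>For a further \<open>x \<in> D\<close> and \<open>c = d \<oslash> e\<close>, both \<open>x \<oslash> c\<close> and \<open>x \<otimes> c\<close> would be partners of
  \<open>x\<close>, so \<open>c \<otimes> c \<in> H\<close>; odd order excludes this.\<close>

lemma D_subset_three_cosets:
  assumes odd_order: "odd (order G)"
    and d: "d \<in> D" and e: "e \<in> D" "d \<oslash> e \<notin> D"
  shows "D \<subseteq> H \<union> (H #> d) \<union> (H #> e)"
proof (rule ccontr)
  assume "\<not> ?thesis"
  then obtain x where x: "x \<in> D" "x \<notin> H" "x \<notin> H #> d" "x \<notin> H #> e" by blast
  have G: "x \<in> carrier G" "d \<in> carrier G" "e \<in> carrier G" using x d e by auto
  \<comment> \<open>Uniqueness is applied twice. If \<open>p \<oslash> x \<notin> D\<close>, then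
    \<open>x\<close> and \<open>q\<close> are both partners of \<open>p\<close>; if
    \<open>q \<oslash> (p \<oslash> x) \<notin> D\<close>, then \<open>p\<close> and
    \<open>p \<oslash> x\<close> are both partners of \<open>q\<close>, whence
    \<open>x \<in> H\<close>. Finally
    \<open>q \<oslash> (p \<oslash> x) = x \<oslash> (p \<oslash> q)\<close>.\<close>
  have step: "x \<oslash> (p \<oslash> q) \<in> D"
    if p: "p \<in> D" and q: "q \<in> D" "q \<oslash> p \<notin> D" and xq: "x \<notin> H #> q" for p q
  proof -
    have pqG: "p \<in> carrier G" "q \<in> carrier G" using p q by auto
    have pq: "p \<oslash> q \<notin> D" using q pqG D_commute by blast
    have "p \<oslash> x \<in> D"
    proof (rule ccontr)
      assume "p \<oslash> x \<notin> D"
      then have "x \<oslash> q \<in> H" using partner_unique p q(1) pq x(1) by blast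
      then show False using xq H.rcos_module[OF is_group pqG(2) G(1)] by blast
    qed
    have "q \<oslash> (p \<oslash> x) \<in> D"
    proof (rule ccontr)
      assume "q \<oslash> (p \<oslash> x) \<notin> D"
      then have "p \<oslash> (p \<oslash> x) \<in> H" using partner_unique[OF q(1) p q(2) \<open>p \<oslash> x \<in> D\<close>] by blast
      then show False using x(2) pqG G by (simp add: quotient_op_cancel_left)
    qed
    then show ?thesis using quotient_op_swap pqG G by simp
  qed
  define c where "c = d \<oslash> e"
  have c: "c \<in> carrier G" "inv c = e \<oslash> d" "c \<notin> D" "inv c \<notin> D"
    using G e(2) D_commute by (auto simp: c_def inv_quotient_op)
  have 1: "x \<oslash> c \<in> D" using step[OF d e(1)] c x by (simp add: c_def D_commute G)
  have "x \<oslash> (e \<oslash> d) \<in> D" using step[OF e(1) d e(2)] x by simp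
  then have 2: "x \<oslash> inv c \<in> D" using c(2) by (simp only:)
  have "(x \<oslash> c) \<oslash> (x \<oslash> inv c) \<in> H"
  proof (rule partner_unique[OF x(1) 1 _ 2])
    show "x \<oslash> (x \<oslash> c) \<notin> D"
      using c G quotient_op_cancel_left[of x c] by metis
    show "x \<oslash> (x \<oslash> inv c) \<notin> D"
      using c G quotient_op_cancel_left[of x "inv c"] by (metis inv_closed)
  qed
  also have "(x \<oslash> c) \<oslash> (x \<oslash> inv c) = inv c \<oslash> c"
    using c G by (intro quotient_op_quotient_op_left) auto
  finally have "inv c \<in> H" using square_mem_subgroup[OF odd_order subgroup_H] c(1) inv_closed by blast
  then show False using c H_subset_D by blast
qed

section \<open>The two cosets of \<open>A\<close> and the order of \<open>g\<close> modulo
  \<open>H\<close>\<close>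

text \<open>Three cosets cover \<open>D\<close>, so \<open>2 * card A - card H = card D\<close> is
  at most \<open>3 * card H\<close>.\<close>

lemma card_A_le_twice:
  assumes "odd (order G)"
  shows "card A \<le> 2 * card H"
proof -
  obtain d where d: "d \<in> D" "d \<notin> H" using D_not_subset_H by blast
  obtain e where e: "e \<in> D" "d \<oslash> e \<notin> D" using partner_exists d by blast
  have "card D \<le> card (H \<union> (H #> d) \<union> (H #> e))"
    using D_subset_three_cosets[OF assms d(1) e] d e finite_H finite_rcos
    by (intro card_mono) auto
  also have "\<dots> \<le> card H + card (H #> d) + card (H #> e)"
    using card_Un_le[of "H \<union> (H #> d)" "H #> e"] card_Un_le[of H "H #> d"] by linarith
  also have "\<dots> = 3 * card H" using d e by (simp add: card_rcos)
  finally show ?thesis using card_D by linarith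
qed

lemma rcos_subset_A: "a \<in> A \<Longrightarrow> H #> a \<subseteq> A"
proof
  fix b assume "a \<in> A" "b \<in> H #> a"
  then obtain h where "h \<in> H" "b = h \<otimes> a" by (auto simp: r_coset_def)
  then show "b \<in> A" using A_mult_H m_comm A_mem_carrier H_carrier \<open>a \<in> A\<close> by metis
qed

text \<open>Two distinct cosets inside \<open>A\<close> already reach the upper bound
  \<open>2 * card H\<close>; \<open>g\<close> is the quotient of their representatives.\<close>

lemma A_two_cosets:
  assumes "odd (order G)"
  obtains x g where "x \<in> carrier G" "g \<in> D" "g \<notin> H"
    "A = (H #> x) \<union> (H #> (x \<otimes> g))" "card A = 2 * card H"
proof -
  obtain x where x: "x \<in> A" using A_nonempty by blast
  obtain b where b: "b \<in> A" "b \<oslash> x \<notin> H" using A_other_coset x by blast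
  have eq: "x \<otimes> (b \<oslash> x) = b" using x b by (simp add: m_comm[of x] quotient_op_cancel_right)
  have sub: "(H #> b) \<union> (H #> x) \<subseteq> A" using rcos_subset_A x b by blast
  have "(H #> b) \<inter> (H #> x) = {}"
    using x b by (simp add: rcosets_disjoint_iff subgroup_H)
  then have c: "card ((H #> b) \<union> (H #> x)) = 2 * card H"
    using x b by (simp add: card_Un_disjoint finite_rcos card_rcos)
  then have "(H #> b) \<union> (H #> x) = A"
    using sub finite_A card_A_le_twice[OF assms] by (intro card_seteq) auto
  then show thesis
    using that[of x "b \<oslash> x"] c x b eq D_I by (simp add: Un_commute)
qed

text \<open>Now \<open>card D = 3 * card H\<close>, so it suffices that the three cosets lie in
  \<open>D\<close> and are disjoint. Odd order separates those of \<open>g\<close> and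
  \<open>inv g\<close>, since \<open>inv g \<oslash> g\<close> is the square of
  \<open>inv g\<close>.\<close>

lemma D_eq_three_cosets:
  assumes odd_order: "odd (order G)"
    and g: "g \<in> D" "g \<notin> H" and c: "card A = 2 * card H"
  shows "D = (H #> inv g) \<union> H \<union> (H #> g)"
proof -
  have gG: "g \<in> carrier G" using g by simp
  have ing: "inv g \<notin> H" using g gG H.m_inv_closed[of "inv g"] inv_inv by metis
  then have "inv g \<oslash> g \<notin> H" using square_mem_subgroup[OF odd_order subgroup_H, of "inv g"] gG by blast
  then have 1: "(H #> inv g) \<inter> (H #> g) = {}"
    using gG by (simp add: rcosets_disjoint_iff subgroup_H)
  have 2: "(H #> inv g) \<inter> H = {}" "H \<inter> (H #> g) = {}"
    using g ing gG rcosets_disjoint_iff[OF subgroup_H one_closed, of g]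
      rcosets_disjoint_iff[OF subgroup_H _ one_closed, of "inv g"]
    by (simp_all add: coset_mult_one H.subset)
  have "card ((H #> inv g) \<union> H \<union> (H #> g)) = 3 * card H"
    using 1 2 gG finite_H by (simp add: card_Un_disjoint finite_rcos card_rcos Int_Un_distrib2)
  moreover have "(H #> inv g) \<union> H \<union> (H #> g) \<subseteq> D"
    using rcos_subset_D D_inv g H_subset_D by simp
  ultimately show ?thesis
    using card_D c finite_D by (intro card_seteq[symmetric]) auto
qed

text \<open>Otherwise multiplication by \<open>g\<close> would permute the three cosets cyclically,
  so \<open>g\<close> would stabilise \<open>D\<close> and lie in \<open>H\<close>.\<close>

lemma cube_notin_H:
  assumes g: "g \<in> D" "g \<notin> H" and D_eq: "D = (H #> inv g) \<union> H \<union> (H #> g)"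
  shows "g \<otimes> g \<otimes> g \<notin> H"
proof
  assume cube: "g \<otimes> g \<otimes> g \<in> H"
  have gG: "g \<in> carrier G" using g by simp
  have "g \<otimes> d \<in> D" if d: "d \<in> D" for d
  proof -
    consider h where "h \<in> H" "d = h \<oslash> g" | "d \<in> H" | h where "h \<in> H" "d = h \<otimes> g"
      using d unfolding D_eq r_coset_def by blast
    then show ?thesis
    proof cases
      case 1
      then have "g \<otimes> d = h" using gG by (simp add: m_comm[of g] quotient_op_cancel_right)
      then show ?thesis using 1 H_subset_D by blast
    next
      case 2
      then show ?thesis using D_mult_H g by blast
    next
      case 3
      have "g \<otimes> d = h \<otimes> (g \<otimes> g)" using 3 gG by (simp add: m_ac)
      also have "g \<otimes> g = (g \<otimes> g \<otimes> g) \<oslash> g" using gG by (simp add: m_assoc)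
      finally show ?thesis using cube 3 g D_inv H_mult_D by metis
    qed
  qed
  then show False using H_I gG g by blast
qed

text \<open>The order divides \<open>order G\<close> by Lagrange, hence is odd;
  \<open>g \<notin> H\<close> excludes 1 and \<open>cube_notin_H\<close> excludes 3.\<close>

lemma ord_FactGroup:
  assumes odd_order: "odd (order G)"
    and g: "g \<in> D" "g \<notin> H" and D_eq: "D = (H #> inv g) \<union> H \<union> (H #> g)"
  shows "odd (group.ord (G Mod H) (H #> g))" "group.ord (G Mod H) (H #> g) \<ge> 5"
proof -
  interpret N: normal H G using subgroup_H by (rule subgroup_imp_normal)
  interpret Q: group "G Mod H" by (rule N.factorgroup_is_group)
  have gG: "g \<in> carrier G" using g by simp
  have mem: "H #> g \<in> carrier (G Mod H)"
    using gG by (auto simp: carrier_FactGroup)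
  have "order (G Mod H) dvd order G"
    using lagrange[OF subgroup_H] by (metis FactGroup_def dvdI order_def partial_object.select_convs(1))
  then show odd_ord: "odd (Q.ord (H #> g))"
    using Q.ord_dvd_group_order[OF mem] odd_order dvd_trans by blast
  have "H #> (g [^] Q.ord (H #> g)) = H"
    using Q.pow_ord_eq_1[OF mem] gG by (simp add: N.FactGroup_pow)
  then have pow: "g [^] Q.ord (H #> g) \<in> H"
    using coset_join1 gG subgroup_H by simp
  have "Q.ord (H #> g) \<noteq> 1" using pow g gG by auto
  moreover have "Q.ord (H #> g) \<noteq> 3"
    using pow cube_notin_H[OF g D_eq] gG by (auto simp: numeral_3_eq_3)
  moreover have "n \<ge> 5" if "odd n" "n \<noteq> 1" "n \<noteq> 3" for n :: nat
    using that by presburger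
  ultimately show "Q.ord (H #> g) \<ge> 5" using odd_ord by blast
qed

end

theorem corollary1p3:
  fixes G :: "('a, 'b) monoid_scheme" (structure) and A :: "'a set"
  assumes "comm_group G" and "finite (carrier G)" and "odd (order G)"
    and "A \<subseteq> carrier G" and "A \<noteq> {}"
    and "\<forall>d \<in> difference_set G A. real (rep_count G A d) \<ge> real (card A) / 2"
  shows "subgroup (difference_set G A) G \<or>
    (\<exists>H x g. subgroup H G \<and> x \<in> carrier G \<and> g \<in> carrier G \<and>
      A = (H #> x) \<union> (H #> (x \<otimes> g)) \<and>
      difference_set G A = (H #> inv g) \<union> H \<union> (H #> g) \<and>
      odd (group.ord (G Mod H) (H #> g)) \<and>
      group.ord (G Mod H) (H #> g) \<ge> 5)"
proof (unfold disj_imp, rule impI)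
  assume not_subgroup: "\<not> subgroup (difference_set G A) G"
  interpret comm_group G by fact
  interpret half_popular G A
  proof
    fix d assume "d \<in> difference_set G A"
    then have "real (card A) / 2 \<le> real (rep_count G A d)" using assms(6) by blast
    then show "card A \<le> 2 * rep_count G A d" by linarith
  qed (use assms not_subgroup finite_subset in auto)
  obtain x g where xg: "x \<in> carrier G" "g \<in> D" "g \<notin> H"
    "A = (H #> x) \<union> (H #> (x \<otimes> g))" "card A = 2 * card H"
    using A_two_cosets[OF assms(3)] by blast
  have D_eq: "D = (H #> inv g) \<union> H \<union> (H #> g)"
    using D_eq_three_cosets[OF assms(3)] xg by blast
  show "\<exists>H x g. subgroup H G \<and> x \<in> carrier G \<and> g \<in> carrier G \<and>
      A = (H #> x) \<union> (H #> (x \<otimes> g)) \<and>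
      difference_set G A = (H #> inv g) \<union> H \<union> (H #> g) \<and>
      odd (group.ord (G Mod H) (H #> g)) \<and>
      group.ord (G Mod H) (H #> g) \<ge> 5"
    using subgroup_H xg(1) D_carrier[OF xg(2)] xg(4) D_eq
      ord_FactGroup[OF assms(3) xg(2,3) D_eq] by blast
qed

end
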